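(* Let $G$ be a finite simple graph with girth at least five. Then $G$ is strongly reconstructible from its digital convexity $\mathscr{D}(G)$; that is, for every graph $H$ on the same vertex set as $G$, $\mathscr{D}(G) = \mathscr{D}(H)$ implies $G = H$.
   Context: All graphs are simple and finite. The girth of a graph is the length of a shortest cycle (infinite if the graph has no cycle). For a vertex $v$ of a graph $G$, the closed neighborhood is $N_G[v] = \{v\} \cup N_G(v)$, where $N_G(v)$ is the set of vertices adjacent to $v$; for $S \subseteq V(G)$, $N_G[S] = \bigcup_{v \in S} N_G[v]$. A set $S \subseteq V(G)$ is digitally convex if for each vertex $v \notin S$ there is a vertex $x \in N_G[v] \setminus N_G[S]$. The digital convexity $\mathscr{D}(G)$ is the collection of all digitally convex sets of $G$. A (labeled) graph $G$ is strongly reconstructible from a parameter $p(G)$ if, for every (labeled) graph $H$ on the same vertex set as $G$, $p(G) = p(H)$ implies $G = H$ (equality of labeled graphs, i.e. the same edge set). *)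

theory Defs
  imports "Graph_Theory.Pair_Digraph" "HOL-Library.Extended_Nat"
begin

text \<open>
  A finite simple graph is a \<open>pair_graph\<close>: a finite vertex set with a symmetric, irreflexive set of
  arcs, in which an edge is represented by its two orientations. Equality of such records is equality
  of labeled graphs.
\<close>

text \<open>
  \<open>pre_digraph.cycle\<close> puts no lower bound on the length, so in a symmetric digraph it also
  accepts the closed walk back and forth along a single edge. The bound 3 excludes exactly these,
  and then the cycles are the oriented and rooted cycles of the undirected graph. The infimum of
  the empty set in \<open>enat\<close> is \<open>\<infinity>\<close>.
\<close>
definition girth :: "'a pair_pre_digraph \<Rightarrow> enat" where
  "girth G = (INF p \<in> {p. pre_digraph.cycle (with_proj G) p \<and> 3 \<le> length p}. enat (length p))"

definition neighborhood :: "'a pair_pre_digraph \<Rightarrow> 'a \<Rightarrow> 'a set" where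
  "neighborhood G v = {w \<in> pverts G. (v, w) \<in> parcs G}"

definition closed_neighborhood :: "'a pair_pre_digraph \<Rightarrow> 'a \<Rightarrow> 'a set" where
  "closed_neighborhood G v = {v} \<union> neighborhood G v"

definition closed_neighborhood_set :: "'a pair_pre_digraph \<Rightarrow> 'a set \<Rightarrow> 'a set" where
  "closed_neighborhood_set G S = (\<Union>v\<in>S. closed_neighborhood G v)"

definition digitally_convex :: "'a pair_pre_digraph \<Rightarrow> 'a set \<Rightarrow> bool" where
  "digitally_convex G S \<longleftrightarrow> S \<subseteq> pverts G \<and>
     (\<forall>v \<in> pverts G - S. \<exists>x. x \<in> closed_neighborhood G v - closed_neighborhood_set G S)"

definition digital_convexity :: "'a pair_pre_digraph \<Rightarrow> 'a set set" where
  "digital_convexity G = {S. digitally_convex G S}"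

definition strongly_reconstructible ::
    "('a pair_pre_digraph \<Rightarrow> 'p) \<Rightarrow> 'a pair_pre_digraph \<Rightarrow> bool" where
  "strongly_reconstructible p G \<longleftrightarrow>
     (\<forall>H. pair_graph H \<longrightarrow> pverts H = pverts G \<longrightarrow> p G = p H \<longrightarrow> G = H)"

end

theory Submission
  imports Defs
begin

text \<open>
  Write \<open>N[v]\<close> for closed neighborhoods. The complement of \<open>N[x]\<close> is digitally convex, and
  convexity of that set in another graph \<open>H\<close> says precisely that \<open>N\<^sub>G[x]\<close> is a union of closed
  neighborhoods of \<open>H\<close>. Hence graphs with the same digital convexity have closed neighborhoods
  that are unions of one another's (\<open>closed_neighborhood_union_of_closed_neighborhoods\<close>), and it
  remains to recover a graph \<open>G\<close> without triangles and 4-cycles from its closed neighborhoods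
  \<^emph>\<open>up to taking unions\<close>, against a competitor \<open>H\<close> with closed neighborhoods \<open>M\<close>
  (\<open>closed_neighborhoods_unique\<close>).

  A closed neighborhood that is not a union of smaller ones must occur among those of \<open>H\<close>, so
  \<open>N[v] = M[x]\<close> for some \<open>x\<close>. Without triangles, a strictly smaller closed neighborhood inside
  \<open>N[v]\<close> belongs to a leaf attached to \<open>v\<close>; so this applies to every \<open>v\<close> that is not the
  center of a star component. In the star components the leaves have irreducible neighborhoods, and
  these determine the component. Outside of them, if \<open>x \<noteq> v\<close>, then \<open>x\<close> is a
  neighbor of \<open>v\<close>, the graph \<open>H\<close> swaps the neighborhoods of \<open>v\<close> and \<open>x\<close>, and the uniqueness of
  common neighbors (no 4-cycles) leaves no room for further neighbors of \<open>v\<close> and \<open>x\<close>. Then the edge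
  \<open>vx\<close> is a component, which is itself a star.
\<close>

section \<open>Reflexive symmetric neighborhood systems\<close>

text \<open>
  Closed neighborhoods are treated as a function on the whole type, with \<open>N v = {v}\<close> for the
  points outside of the graph, so that no vertex set has to be carried along.
\<close>

locale neighborhood_system =
  fixes N :: "'a \<Rightarrow> 'a set"
  assumes self_in: "v \<in> N v"
    and sym: "u \<in> N v \<Longrightarrow> v \<in> N u"

text \<open>
  The two conditions exclude triangles and 4-cycles.
\<close>

locale girth_five_system = neighborhood_system N for N :: "'a \<Rightarrow> 'a set" +
  assumes adjacent_common: "\<lbrakk>u \<in> N v; u \<noteq> v; x \<in> N u; x \<in> N v\<rbrakk> \<Longrightarrow> x = u \<or> x = v"
    and nonadjacent_common: "\<lbrakk>u \<notin> N v; x \<in> N u; x \<in> N v; y \<in> N u; y \<in> N v\<rbrakk> \<Longrightarrow> x = y"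
begin

lemma subset_neighborhood_leaf:
  assumes "N w \<subseteq> N v" "w \<noteq> v"
  shows "N w = {v, w}"
proof -
  have "w \<in> N v" using assms(1) self_in by blast
  then show ?thesis using adjacent_common[of w v] assms sym self_in by blast
qed

definition star_center :: "'a \<Rightarrow> bool" where
  "star_center c \<longleftrightarrow> N c \<noteq> {c} \<and> (\<forall>l \<in> N c - {c}. N l = {c, l})"

end

text \<open>
  The two assumptions say, point by point, that the sets of each system are unions of sets of the
  other one.
\<close>

locale union_equivalent_systems = girth_five_system N + M: neighborhood_system M
  for N M :: "'a \<Rightarrow> 'a set" +
  assumes N_union_of_M: "y \<in> N x \<Longrightarrow> \<exists>z. y \<in> M z \<and> M z \<subseteq> N x"
    and M_union_of_N: "y \<in> M x \<Longrightarrow> \<exists>z. y \<in> N z \<and> N z \<subseteq> M x"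
begin

text \<open>
  The point \<open>u\<close> witnesses that \<open>N v\<close> is not a union of smaller sets of the system: it lies in
  some \<open>M x \<subseteq> N v\<close>, and there again in some \<open>N w \<subseteq> M x\<close>, which leaves no room between
  \<open>N w\<close> and \<open>N v\<close>.
\<close>

lemma irreducible_neighborhood_occurs:
  assumes "u \<in> N v" and "\<And>w. \<lbrakk>u \<in> N w; N w \<subseteq> N v\<rbrakk> \<Longrightarrow> N w = N v"
  obtains x where "M x = N v" "x \<in> N v"
proof -
  obtain x where x: "u \<in> M x" "M x \<subseteq> N v" using N_union_of_M assms(1) by blast
  obtain w where w: "u \<in> N w" "N w \<subseteq> M x" using M_union_of_N x(1) by blast
  have "N w = N v" using assms(2) x w by blast
  then have "M x = N v" using x w by blast
  then show thesis using that M.self_in by blast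
qed

text \<open>
  An isolated point witnesses the irreducibility of its own neighborhood. For any other \<open>v\<close>, the
  witness is a neighbor that is not a leaf.
\<close>

lemma non_center_neighborhood_occurs:
  assumes "\<not> star_center v"
  obtains x where "M x = N v" "x \<in> N v"
proof (cases "N v = {v}")
  case True
  then have "N w = N v" if "v \<in> N w" "N w \<subseteq> N v" for w using that by auto
  then show thesis using irreducible_neighborhood_occurs[of v v] self_in that by blast
next
  case False
  then obtain u where u: "u \<in> N v" "u \<noteq> v" "N u \<noteq> {v, u}"
    using assms unfolding star_center_def by blast
  have "N w = N v" if "u \<in> N w" "N w \<subseteq> N v" for w
    using subset_neighborhood_leaf[of w v] that u by blast
  then show thesis using irreducible_neighborhood_occurs[of u v] u that by blast
qed

text \<open>
  Each leaf \<open>l\<close> of a star with center \<open>c\<close> has an irreducible neighborhood \<open>{c, l}\<close>, which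
  therefore belongs to \<open>c\<close> or to \<open>l\<close> in the other system as well. If it belongs to \<open>c\<close>,
  then the star is a single edge.
  No point \<open>y\<close> outside of the star is attached to it in the other system: its neighborhood there
  is a union of sets of the first system, so it would contain a leaf together with the center.
\<close>

lemma star_neighborhoods_eq:
  assumes c: "star_center c" and v: "v \<in> N c"
  shows "M v = N v"
proof -
  have leaf: "N l = {c, l}" if "l \<in> N c" "l \<noteq> c" for l
    using c that unfolding star_center_def by blast
  obtain l0 where l0: "l0 \<in> N c" "l0 \<noteq> c"
    using c self_in unfolding star_center_def by blast
  have occurs: "M c = {c, l} \<or> M l = {c, l}" if l: "l \<in> N c" "l \<noteq> c" for l
  proof -
    have "N w = N l" if w: "l \<in> N w" "N w \<subseteq> N l" for w
    proof (cases "w = l")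
      case False
      then have "N w = {l, w}" using subset_neighborhood_leaf w by blast
      moreover have "w = c" using sym[OF w(1)] leaf[OF l] False by auto
      ultimately show ?thesis using leaf[OF l] by auto
    qed simp
    then obtain x where "M x = N l" "x \<in> N l"
      using irreducible_neighborhood_occurs[of l l] self_in by blast
    then show ?thesis using leaf[OF l] by auto
  qed
  show ?thesis
  proof (cases "\<exists>l \<in> N c - {c}. M c = {c, l}")
    case True
    then obtain l where l: "l \<in> N c" "l \<noteq> c" "M c = {c, l}" by blast
    \<comment> \<open>A second leaf would be adjacent to \<open>c\<close> in the other system.\<close>
    have "l' = l" if l': "l' \<in> N c" "l' \<noteq> c" for l'
    proof (rule ccontr)
      assume "l' \<noteq> l"
      then have "M c \<noteq> {c, l'}" using l l' by auto
      then have "M l' = {c, l'}" using occurs[OF l'] by blast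
      then have "l' \<in> M c" using M.sym[of c l'] by blast
      then show False using l l' \<open>l' \<noteq> l\<close> by blast
    qed
    then have Nc: "N c = {c, l}" using l self_in by blast
    have Nl: "N l = {c, l}" using leaf l by blast
    have "M l \<subseteq> {c, l}"
    proof
      fix y assume "y \<in> M l"
      then obtain z where z: "l \<in> N z" "N z \<subseteq> M y" using M.sym M_union_of_N by blast
      then have "z \<in> {c, l}" using sym Nl by blast
      then have "c \<in> M y" using z Nc Nl by auto
      then show "y \<in> {c, l}" using M.sym l by blast
    qed
    moreover have "c \<in> M l" using l M.sym[of l c] by blast
    ultimately have "M l = {c, l}" using M.self_in by blast
    then show ?thesis using v Nc Nl l by auto
  next
    case False
    then have Ml: "M l = {c, l}" if "l \<in> N c" "l \<noteq> c" for l using occurs that by blast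
    have "l \<in> M c" if "l \<in> N c" for l
      using that Ml[of l] M.sym[of c l] M.self_in by blast
    moreover have "y \<in> N c" if y: "y \<in> M c" for y
    proof -
      obtain z where z: "c \<in> N z" "N z \<subseteq> M y" using y M.sym M_union_of_N by blast
      then have "z \<in> N c" using sym by blast
      then obtain l where l: "l \<in> N c" "l \<noteq> c" "l \<in> N z"
        using l0 self_in[of z] by (cases "z = c") auto
      then have "y \<in> M l" using z M.sym by blast
      then have "y \<in> {c, l}" using Ml[OF l(1,2)] by simp
      then show ?thesis using l(1) self_in[of c] by auto
    qed
    ultimately have "M c = N c" by blast
    then show ?thesis using v leaf Ml by (cases "v = c") auto
  qed
qed

text \<open>
  Here \<open>v\<close> and all its neighbors have neighborhoods that occur in the other system. If \<open>N v\<close> occurs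
  there at some \<open>z \<noteq> v\<close>, then \<open>N z\<close> can only occur at \<open>v\<close>, and the neighborhood of
  a further neighbor \<open>u\<close> of \<open>v\<close> can only occur at \<open>v\<close>, too, where it would collide with \<open>N z\<close>.
\<close>

lemma non_star_neighborhood_eq:
  assumes non_star: "\<And>c. star_center c \<Longrightarrow> v \<notin> N c"
  shows "M v = N v"
proof -
  have occurs: "\<exists>x. M x = N u \<and> x \<in> N u" if "u \<in> N v" for u
  proof -
    have "\<not> star_center u" using non_star sym[OF that] by blast
    then show ?thesis using non_center_neighborhood_occurs by metis
  qed
  obtain z where z: "M z = N v" "z \<in> N v" using occurs self_in by blast
  show ?thesis
  proof (cases "z = v")
    case True
    then show ?thesis using z by simp
  next
    case False
    have not_edge: False if "N v = {v, z}" "N z = {v, z}"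
    proof -
      have "star_center v" using that False unfolding star_center_def by auto
      then show False using non_star self_in by blast
    qed
    obtain y where y: "M y = N z" "y \<in> N z" using occurs z by blast
    have "y \<in> N v" using y z M.sym[of z y] self_in by blast
    then have "y = z \<or> y = v" using adjacent_common[of z v y] z y False by blast
    moreover have "y \<noteq> z"
    proof
      assume "y = z"
      then have "N z = N v" using y z by simp
      then show False
        using not_edge subset_neighborhood_leaf[of z v] False by blast
    qed
    ultimately have Mv: "M v = N z" using y by blast
    have "u = v \<or> u = z" if u: "u \<in> N v" for u
    proof (rule ccontr)
      assume neq: "\<not> (u = v \<or> u = z)"
      obtain x where x: "M x = N u" "x \<in> N u" using occurs u by blast
      have nonadj: "u \<notin> N z" using adjacent_common[of z v u] z u False neq by blast
      have "v \<in> M x" using x u sym by blast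
      then have "x \<in> N z" using Mv M.sym by blast
      \<comment> \<open>The points \<open>u\<close> and \<open>z\<close> have \<open>v\<close> as their only common neighbor.\<close>
      then have "x = v" using nonadjacent_common[OF nonadj] x u z sym by blast
      then have "N u = N z" using x Mv by simp
      then show False using nonadj self_in by blast
    qed
    then have Nv: "N v = {v, z}" using z self_in by blast
    have "N z \<subseteq> {v, z}"
    proof
      fix y assume "y \<in> N z"
      then have "v \<in> M y" using Mv M.sym by blast
      then obtain w where w: "v \<in> N w" "N w \<subseteq> M y" using M_union_of_N by blast
      then have "w \<in> {v, z}" using sym Nv by blast
      then have "z \<in> M y" using w z self_in by blast
      then show "y \<in> {v, z}" using M.sym z Nv by blast
    qed
    then have "N z = {v, z}" using z sym self_in by blast
    then show ?thesis using not_edge Nv by blast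
  qed
qed

theorem closed_neighborhoods_unique: "M = N"
  using star_neighborhoods_eq non_star_neighborhood_eq by blast

end

section \<open>Closed neighborhoods, girth and digital convexity of graphs\<close>

lemma in_closed_neighborhood_iff:
  assumes "pair_graph G"
  shows "w \<in> closed_neighborhood G v \<longleftrightarrow> w = v \<or> (v, w) \<in> parcs G"
proof -
  interpret pair_graph G by fact
  show ?thesis
    unfolding closed_neighborhood_def neighborhood_def by (auto dest: in_arcsD2)
qed

lemma neighborhood_system_closed_neighborhood:
  assumes "pair_graph G"
  shows "neighborhood_system (closed_neighborhood G)"
proof -
  interpret pair_graph G by fact
  show ?thesis
    by unfold_locales (auto simp: in_closed_neighborhood_iff[OF assms] intro: arcs_symmetric)
qed

lemma girth_le_cycle_length:
  assumes "pre_digraph.cycle (with_proj G) p" "3 \<le> length p"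
  shows "girth G \<le> enat (length p)"
  unfolding girth_def by (rule INF_lower) (use assms in simp)

lemma no_triangle:
  assumes "pair_graph G" "4 \<le> girth G"
    and arcs: "(a, b) \<in> parcs G" "(b, c) \<in> parcs G" "(c, a) \<in> parcs G"
  shows False
proof -
  interpret pair_graph G by fact
  have "a \<noteq> b" "b \<noteq> c" "c \<noteq> a" using arcs no_loops' by blast+
  then have "cycle [(a, b), (b, c), (c, a)]"
    unfolding cycle_def using arcs
    by (auto simp: awalk_def intro!: exI[of _ a] dest: in_arcsD1 in_arcsD2)
  from girth_le_cycle_length[OF this] have "girth G \<le> enat 3" by (simp add: numeral_3_eq_3)
  with assms(2) have "4 \<le> enat 3" by (rule order_trans)
  then show False by (simp add: numeral_eq_enat)
qed

lemma no_quadrangle: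
  assumes "pair_graph G" "5 \<le> girth G"
    and arcs: "(a, b) \<in> parcs G" "(b, c) \<in> parcs G" "(c, d) \<in> parcs G" "(d, a) \<in> parcs G"
    and diag: "a \<noteq> c" "b \<noteq> d"
  shows False
proof -
  interpret pair_graph G by fact
  have "a \<noteq> b" "b \<noteq> c" "c \<noteq> d" "d \<noteq> a" using arcs no_loops' by blast+
  then have "cycle [(a, b), (b, c), (c, d), (d, a)]"
    unfolding cycle_def using arcs diag
    by (auto simp: awalk_def intro!: exI[of _ a] dest: in_arcsD1 in_arcsD2)
  from girth_le_cycle_length[OF this] have "girth G \<le> enat 4" by (simp add: eval_nat_numeral)
  with assms(2) have "5 \<le> enat 4" by (rule order_trans)
  then show False by (simp add: numeral_eq_enat)
qed

lemma girth_five_system_closed_neighborhood: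
  assumes G: "pair_graph G" and girth: "5 \<le> girth G"
  shows "girth_five_system (closed_neighborhood G)"
proof -
  interpret pair_graph G by fact
  interpret N: neighborhood_system "closed_neighborhood G"
    by (rule neighborhood_system_closed_neighborhood[OF G])
  note mem = in_closed_neighborhood_iff[OF G]
  have girth4: "4 \<le> girth G" by (rule order_trans[OF _ girth]) simp
  show ?thesis
  proof
    fix u v x
    assume "u \<in> closed_neighborhood G v" "u \<noteq> v"
      "x \<in> closed_neighborhood G u" "x \<in> closed_neighborhood G v"
    then show "x = u \<or> x = v"
      using no_triangle[OF G girth4, of v u x] arcs_symmetric unfolding mem by blast
  next
    fix u v x y
    assume "u \<notin> closed_neighborhood G v"
      "x \<in> closed_neighborhood G u" "x \<in> closed_neighborhood G v"
      "y \<in> closed_neighborhood G u" "y \<in> closed_neighborhood G v"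
    then show "x = y"
      using no_quadrangle[OF G girth, of u x v y] arcs_symmetric unfolding mem by blast
  qed
qed

lemma closed_neighborhood_subset_pverts:
  "v \<in> pverts G \<Longrightarrow> closed_neighborhood G v \<subseteq> pverts G"
  unfolding closed_neighborhood_def neighborhood_def by blast

text \<open>
  The vertex \<open>x\<close> itself separates each point of its closed neighborhood from the complement.
\<close>

lemma digitally_convex_complement_closed_neighborhood:
  assumes "pair_graph G"
  shows "digitally_convex G (pverts G - closed_neighborhood G x)"
proof -
  interpret N: neighborhood_system "closed_neighborhood G"
    by (rule neighborhood_system_closed_neighborhood[OF assms])
  show ?thesis
    unfolding digitally_convex_def closed_neighborhood_set_def using N.sym by blast
qed

text \<open>
  The vertex that separates \<open>y\<close> from the complement of \<open>N\<^sub>G[x]\<close> in \<open>H\<close> has its closed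
  neighborhood disjoint from this complement, hence inside \<open>N\<^sub>G[x]\<close>.
\<close>

lemma closed_neighborhood_union_of_closed_neighborhoods:
  assumes G: "pair_graph G" and H: "pair_graph H" and verts: "pverts H = pverts G"
    and conv: "digital_convexity G \<subseteq> digital_convexity H"
    and y: "y \<in> closed_neighborhood G x"
  shows "\<exists>z. y \<in> closed_neighborhood H z \<and> closed_neighborhood H z \<subseteq> closed_neighborhood G x"
proof (cases "x \<in> pverts G")
  case True
  interpret H: neighborhood_system "closed_neighborhood H"
    by (rule neighborhood_system_closed_neighborhood[OF H])
  let ?S = "pverts G - closed_neighborhood G x"
  have "digitally_convex H ?S"
    using digitally_convex_complement_closed_neighborhood[OF G] conv
    unfolding digital_convexity_def by blast
  moreover have yV: "y \<in> pverts H"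
    using y closed_neighborhood_subset_pverts[OF True] verts by blast
  ultimately obtain z
    where z: "z \<in> closed_neighborhood H y" "z \<notin> closed_neighborhood_set H ?S"
    using y unfolding digitally_convex_def by blast
  have "z \<in> pverts H" using z(1) closed_neighborhood_subset_pverts[OF yV] by blast
  then have "closed_neighborhood H z \<subseteq> pverts G"
    using closed_neighborhood_subset_pverts[of z H] verts by simp
  moreover have "closed_neighborhood H z \<inter> ?S = {}"
    using z(2) H.sym unfolding closed_neighborhood_set_def by blast
  ultimately show ?thesis using z(1) H.sym by blast
next
  case False
  interpret G: pair_graph G by fact
  interpret H: pair_graph H by fact
  have "closed_neighborhood G x = {x}" "closed_neighborhood H x = {x}"
    using False verts in_closed_neighborhood_iff[OF G, of _ x] in_closed_neighborhood_iff[OF H, of _ x]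
    by (auto dest: G.in_arcsD1 H.in_arcsD1)
  then show ?thesis using y by auto
qed

lemma closed_neighborhood_determines_graph:
  assumes G: "pair_graph G" and H: "pair_graph H" and verts: "pverts H = pverts G"
    and nbh: "closed_neighborhood H = closed_neighborhood G"
  shows "G = H"
proof -
  interpret G: pair_graph G by fact
  interpret H: pair_graph H by fact
  have "(u, v) \<in> parcs G \<longleftrightarrow> (u, v) \<in> parcs H" for u v
    using in_closed_neighborhood_iff[OF G, of v u] in_closed_neighborhood_iff[OF H, of v u]
      nbh G.no_loops' H.no_loops' by auto
  then show ?thesis using verts by (intro pair_pre_digraph.equality) auto
qed

theorem corollary1p7:
  fixes G :: "'a pair_pre_digraph"
  assumes "pair_graph G" and "5 \<le> girth G"
  shows "strongly_reconstructible digital_convexity G"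
  unfolding strongly_reconstructible_def
proof (intro allI impI)
  fix H :: "'a pair_pre_digraph"
  assume H: "pair_graph H" and verts: "pverts H = pverts G"
    and conv: "digital_convexity G = digital_convexity H"
  interpret union_equivalent_systems "closed_neighborhood G" "closed_neighborhood H"
  proof (intro union_equivalent_systems.intro union_equivalent_systems_axioms.intro)
    show "girth_five_system (closed_neighborhood G)"
      by (rule girth_five_system_closed_neighborhood[OF assms])
    show "neighborhood_system (closed_neighborhood H)"
      by (rule neighborhood_system_closed_neighborhood[OF H])
  next
    fix x y
    assume "y \<in> closed_neighborhood G x"
    then show "\<exists>z. y \<in> closed_neighborhood H z \<and> closed_neighborhood H z \<subseteq> closed_neighborhood G x"
      using closed_neighborhood_union_of_closed_neighborhoods[OF assms(1) H verts] conv by simp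
  next
    fix x y
    assume "y \<in> closed_neighborhood H x"
    then show "\<exists>z. y \<in> closed_neighborhood G z \<and> closed_neighborhood G z \<subseteq> closed_neighborhood H x"
      using closed_neighborhood_union_of_closed_neighborhoods[OF H assms(1) verts[symmetric]] conv
      by simp
  qed
  show "G = H"
    by (rule closed_neighborhood_determines_graph[OF assms(1) H verts closed_neighborhoods_unique])
qed

end
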